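(* Let $M$ be a positive measure on $\mathbb{R}$ with moments of all orders $q_n=\int_{-\infty}^\infty x^n\,dM(x)$, $n=0,1,\ldots$, and suppose that $\sqrt[2n]{q_{2n}}=o(n)$ as $n\to\infty$. Then the moment problem is determinate, i.e. $M$ is the only positive measure on $\mathbb{R}$ with the moments $(q_n)_{n\ge 0}$. Moreover, let $A$ be the densely defined operator from $\ell^2=\ell^2(\mathbb{Z}_+)$ to $L^2(M)$ with domain $\mathcal{D}$ given by $Ag(x)=\sum_{n\ge 0} g_n x^n$ for $g=(g_0,g_1,\ldots)\in\mathcal{D}$. If $A$ is closable, then $M(\mathbb{R}\setminus(-1,1))=0$.
   Context: $\ell^2=\ell^2(\mathbb{Z}_+)$ is the Hilbert space of square-summable complex sequences indexed by $n=0,1,2,\ldots$, and $\mathcal{D}\subset\ell^2$ is the dense subspace of complex sequences with only finitely many non-zero terms. $M$ has moments of all orders if $\mathbb{C}[x]\subset L^2(M)$. An operator $A:\mathcal{D}\to L^2(M)$ is closable if whenever $g^{(n)}\in\mathcal{D}$, $g^{(n)}\to 0$ in $\ell^2$ and $Ag^{(n)}\to f$ in $L^2(M)$, then $f=0$. *)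

theory Defs
  imports
    "HOL-Analysis.Analysis"
    "HOL-Computational_Algebra.Polynomial"
    "HOL-Library.Landau_Symbols"
begin

text \<open>
  The spaces \<open>ell^2(Z_+)\<close> and \<open>L^2(M)\<close> are carrier sets of sequences resp. functions.
  Elements of \<open>L^2(M)\<close> are represented by square-integrable functions, so equality in
  \<open>L^2(M)\<close> is equality \<open>M\<close>-almost everywhere.
\<close>

definition ell2 :: "(nat \<Rightarrow> complex) set" where
  "ell2 = {g. summable (\<lambda>n. (cmod (g n))\<^sup>2)}"

definition ell2_norm :: "(nat \<Rightarrow> complex) \<Rightarrow> real" where
  "ell2_norm g = sqrt (\<Sum>n. (cmod (g n))\<^sup>2)"

definition fin_seqs :: "(nat \<Rightarrow> complex) set" where
  "fin_seqs = {g. finite {n. g n \<noteq> 0}}"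

definition L2 :: "'a measure \<Rightarrow> ('a \<Rightarrow> complex) set" where
  "L2 M = {f \<in> borel_measurable M. integrable M (\<lambda>x. (cmod (f x))\<^sup>2)}"

definition L2_norm :: "'a measure \<Rightarrow> ('a \<Rightarrow> complex) \<Rightarrow> real" where
  "L2_norm M f = sqrt (\<integral>x. (cmod (f x))\<^sup>2 \<partial>M)"

text \<open>
  An operator from \<open>ell^2\<close> to \<open>L^2(M)\<close> with domain \<open>D\<close>. Membership in the two spaces is
  stated because both norms take the junk value of a divergent sum or integral otherwise.
\<close>

definition closable_on ::
  "(nat \<Rightarrow> complex) set \<Rightarrow> 'a measure \<Rightarrow> ((nat \<Rightarrow> complex) \<Rightarrow> 'a \<Rightarrow> complex) \<Rightarrow> bool" where
  "closable_on D M A \<longleftrightarrow>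
    D \<subseteq> ell2 \<and> (\<forall>g\<in>D. A g \<in> L2 M) \<and>
    (\<forall>(g :: nat \<Rightarrow> nat \<Rightarrow> complex) f.
      (\<forall>k. g k \<in> D) \<longrightarrow> f \<in> L2 M \<longrightarrow>
      (\<lambda>k. ell2_norm (g k)) \<longlonglongrightarrow> 0 \<longrightarrow>
      (\<lambda>k. L2_norm M (\<lambda>x. A (g k) x - f x)) \<longlonglongrightarrow> 0 \<longrightarrow>
      (AE x in M. f x = 0))"

definition has_moments :: "real measure \<Rightarrow> bool" where
  "has_moments M \<longleftrightarrow> (\<forall>p :: complex poly. (\<lambda>x. poly p (of_real x)) \<in> L2 M)"

definition moment :: "real measure \<Rightarrow> nat \<Rightarrow> real" where
  "moment M n = (\<integral>x. x ^ n \<partial>M)"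

text \<open>
  Competitors must have moments of all orders, since the Bochner integral of a
  non-integrable function is \<open>0\<close>.
\<close>

definition determinate :: "real measure \<Rightarrow> bool" where
  "determinate M \<longleftrightarrow>
    (\<forall>N :: real measure. sets N = sets borel \<longrightarrow> has_moments N \<longrightarrow>
      (\<forall>n. moment N n = moment M n) \<longrightarrow> N = M)"

definition power_series_op :: "(nat \<Rightarrow> complex) \<Rightarrow> real \<Rightarrow> complex" where
  "power_series_op g x = (\<Sum>n | g n \<noteq> 0. g n * of_real x ^ n)"

end

theory Submission
  imports Defs "HOL-Probability.Probability" "HOL-Real_Asymp.Real_Asymp"
begin

text \<open>
  The growth condition on the even moments makes \<open>exp (s * \<bar>x\<bar>)\<close> integrable for every \<open>s\<close>, so
  the characteristic function of \<open>M\<close> is an everywhere convergent power series in the moments;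
  Levy's uniqueness theorem gives determinacy.

  For the support, let \<open>w x = (1 - cos (a * x)) / 2\<close>, which takes values in \<open>[0, 1]\<close> on the real
  line and whose Taylor coefficients have \<open>\<ell>\<^sup>1\<close> norm \<open>r = (cosh a - 1) / 2\<close>. For \<open>r < c \<le> 1\<close> and
  \<open>K = \<lceil>m / c ^ m\<rceil>\<close>, the functions \<open>1 - (1 - w ^ m) ^ K\<close> have Taylor coefficients of norm at most
  \<open>(1 + r ^ m) ^ K - 1\<close>, which tends to \<open>0\<close>, while they converge boundedly to the indicator of
  \<open>w \<ge> c\<close>. Closability thus forces \<open>w \<le> r\<close> almost everywhere, that is
  \<open>1 - cos (a * x) \<le> cosh a - 1\<close>; letting \<open>a\<close> tend to \<open>0\<close> gives \<open>\<bar>x\<bar> \<le> 1\<close>. Atoms at \<open>s = 1\<close> and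
  \<open>s = -1\<close> are excluded by the Cesaro means of \<open>(s * x) ^ n\<close>, whose coefficients have
  \<open>\<ell>\<^sup>2\<close> norm tending to \<open>0\<close>.
\<close>

section \<open>Exponential integrability from the growth of the even moments\<close>

text \<open>Every \<open>s\<close> is allowed because the dominating functions
  \<open>C * exp (r * \<bar>x\<bar>)\<close> that occur later have arbitrary rates, which double
  when they are squared.\<close>

definition exp_integrable :: "real measure \<Rightarrow> bool" where
  "exp_integrable M \<longleftrightarrow> (\<forall>s. integrable M (\<lambda>x. exp (s * \<bar>x\<bar>)))"

text \<open>Square integrability of \<open>x ^ k\<close> covers the even powers; arbitrary powers
  follow from |y| \<le> 1 + y^2 with y = x^n.\<close>

lemma has_moments_integrable_power:
  assumes [measurable_cong]: "sets M = sets borel" and "has_moments M"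
  shows "integrable M (\<lambda>x. x ^ n :: real)"
proof -
  have even_power: "integrable M (\<lambda>x. x ^ (2 * k) :: real)" for k
  proof -
    have "(\<lambda>x. poly (monom 1 k) (complex_of_real x)) \<in> L2 M"
      using assms(2) by (simp only: has_moments_def)
    then have "integrable M (\<lambda>x. (cmod (poly (monom 1 k) (complex_of_real x)))\<^sup>2)"
      by (simp add: L2_def)
    moreover have "(cmod (poly (monom 1 k) (complex_of_real x)))\<^sup>2 = x ^ (2 * k)" for x
      by (simp add: poly_monom norm_power power_even_eq power2_eq_square flip: power_mult_distrib)
    ultimately show ?thesis
      by simp
  qed
  have "integrable M (\<lambda>x. x ^ (2 * 0) + x ^ (2 * n) :: real)"
    by (intro Bochner_Integration.integrable_add even_power)
  then show ?thesis
  proof (rule Bochner_Integration.integrable_bound)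
    have "\<bar>y\<bar> \<le> 1 + y\<^sup>2" for y :: real
      using sum_squares_bound[of "\<bar>y\<bar>" 1] by simp
    then show "AE x in M. norm (x ^ n) \<le> norm (x ^ (2 * 0) + x ^ (2 * n) :: real)"
      by (intro AE_I2) (simp only: real_norm_def power_even_eq mult_0_right power_0 abs_of_nonneg[OF add_nonneg_nonneg] zero_le_power2 zero_le_one)
    show "(\<lambda>x. x ^ n) \<in> borel_measurable M"
      by measurable
  qed
qed

lemma has_moments_finite_measure:
  assumes "sets M = sets borel" "has_moments M"
  shows "finite_measure M"
proof
  have "integrable M (\<lambda>_. 1 :: real)"
    using has_moments_integrable_power[OF assms, of 0] by (simp only: power_0)
  then show "emeasure M (space M) \<noteq> \<infinity>"
    by (simp only: integrable_iff_bounded) (simp add: less_top)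
qed

text \<open>One term of the exponential series at \<open>n\<close> is at most the whole sum. This
  crude Stirling bound lets growth o(n) be compared with factorials.\<close>

lemma power_le_exp_fact: "real n ^ n \<le> exp (real n) * fact n"
proof -
  have "(\<Sum>k\<in>{n}. real n ^ k /\<^sub>R fact k) \<le> (\<Sum>k. real n ^ k /\<^sub>R fact k)"
    by (rule sum_le_suminf) (auto simp: summable_exp)
  then show ?thesis
    by (simp add: exp_def field_simps)
qed

text \<open>The series of \<open>cosh (s * x)\<close> is integrated term by term. Its n-th term has
  integral s^(2n) q_(2n) / (2n)!, and the growth condition makes this decay geometrically for every
  \<open>s\<close>.\<close>

lemma exp_integrable_if_moment_growth:
  assumes [measurable_cong]: "sets M = sets borel" and "has_moments M"
    and growth: "(\<lambda>n. root (2 * n) (moment M (2 * n))) \<in> o(\<lambda>n. real n)"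
  shows "exp_integrable M"
  unfolding exp_integrable_def
proof
  fix s0 :: real
  \<comment> \<open>This \<open>s\<close> is positive, so that it can be divided by, and is at least
    \<open>s0\<close>, so that \<open>2 * cosh (s * x)\<close> dominates
    \<open>exp (s0 * \<bar>x\<bar>)\<close>.\<close>
  define s where "s = \<bar>s0\<bar> + 1"
  have "s > 0" by (simp add: s_def)
  note int = has_moments_integrable_power[OF assms(1,2)]
  define t where "t n x = (s * x) ^ (2 * n) / fact (2 * n)" for n and x :: real
  have t_nonneg: "t n x \<ge> 0" for n x
    by (simp add: t_def zero_le_even_power)
  have t_int: "integrable M (t n)" for n
    unfolding t_def power_mult_distrib by (intro integrable_divide integrable_mult_right int)
  have t_integral: "(\<integral>x. norm (t n x) \<partial>M) = s ^ (2 * n) / fact (2 * n) * moment M (2 * n)" for n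
    using t_nonneg by (simp add: t_def power_mult_distrib moment_def)
  \<comment> \<open>With the constant 1 / (s e) the powers of \<open>s\<close> cancel and e^(-2n)
    absorbs the exponential in \<open>power_le_exp_fact\<close> at 2n; what remains is (n / 2n)^(2n)
    = (1/4)^n.\<close>
  have "\<forall>\<^sub>F n in sequentially. norm (root (2 * n) (moment M (2 * n))) \<le> (1 / (s * exp 1)) * norm (real n)"
    using growth \<open>s > 0\<close> by (intro landau_o.smallD) auto
  with eventually_gt_at_top[of 0]
  have "\<forall>\<^sub>F n in sequentially. norm (\<integral>x. norm (t n x) \<partial>M) \<le> (1 / 4) ^ n"
  proof eventually_elim
    case (elim n)
    have nn: "0 \<le> moment M (2 * n)"
      by (simp add: moment_def zero_le_even_power)
    have "moment M (2 * n) = root (2 * n) (moment M (2 * n)) ^ (2 * n)"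
      using elim nn by simp
    also have "\<dots> \<le> (real n / (s * exp 1)) ^ (2 * n)"
      using elim nn by (intro power_mono) auto
    finally have "s ^ (2 * n) * moment M (2 * n) \<le> s ^ (2 * n) * (real n / (s * exp 1)) ^ (2 * n)"
      using \<open>s > 0\<close> by (intro mult_left_mono) auto
    also have "\<dots> = real n ^ (2 * n) / exp (real (2 * n))"
      using \<open>s > 0\<close> by (simp add: power_divide power_mult_distrib flip: exp_of_nat_mult)
    also have "real n ^ (2 * n) = (1 / 4) ^ n * real (2 * n) ^ (2 * n)"
      by (simp add: power_mult power_mult_distrib power_one_over)
    also have "\<dots> / exp (real (2 * n)) \<le> (1 / 4) ^ n * fact (2 * n)"
      using power_le_exp_fact[of "2 * n"] by (simp add: field_simps)
    finally show ?case
      using nn \<open>s > 0\<close> unfolding t_integral by (simp add: field_simps)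
  qed
  then have "summable (\<lambda>n. \<integral>x. norm (t n x) \<partial>M)"
    by (rule summable_comparison_test_ev) (auto intro!: summable_geometric)
  moreover have t_sums: "(\<lambda>n. t n x) sums cosh (s * x)" for x
  proof -
    have "(\<lambda>n. if even (2*n) then (s * x) ^ (2*n) /\<^sub>R fact (2*n) else 0) sums cosh (s * x)"
      using sums_mono_reindex[of "\<lambda>n. 2 * n" "\<lambda>n. if even n then (s * x) ^ n /\<^sub>R fact n else 0"]
        cosh_converges[of "s * x"]
      by (force simp: strict_mono_def elim!: evenE)
    then show ?thesis
      by (simp add: t_def field_simps)
  qed
  moreover from t_sums have "summable (\<lambda>n. norm (t n x))" for x
    using t_nonneg by (simp add: sums_iff)
  ultimately have "integrable M (\<lambda>x. \<Sum>n. t n x)"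
    using t_int by (intro integrable_suminf) auto
  then have "integrable M (\<lambda>x. 2 * cosh (s * x))"
    using t_sums by (simp add: sums_iff)
  then show "integrable M (\<lambda>x. exp (s0 * \<bar>x\<bar>))"
  proof (rule Bochner_Integration.integrable_bound)
    have "exp (s0 * \<bar>x\<bar>) \<le> 2 * cosh (s * x)" for x
    proof -
      have "s0 * \<bar>x\<bar> \<le> s * \<bar>x\<bar>"
        by (intro mult_right_mono) (auto simp: s_def)
      then have "exp (s0 * \<bar>x\<bar>) \<le> exp (s * \<bar>x\<bar>)" by simp
      also have "\<dots> \<le> exp (s * x) + exp (- (s * x))"
        by (cases "x \<ge> 0") auto
      also have "\<dots> = 2 * cosh (s * x)" by (simp add: cosh_field_def)
      finally show ?thesis .
    qed
    then show "AE x in M. norm (exp (s0 * \<bar>x\<bar>)) \<le> norm (2 * cosh (s * x))"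
      by (simp add: cosh_real_nonneg)
  qed measurable
qed

section \<open>The characteristic function and determinacy\<close>

lemma sum_power_fact_le_exp:
  fixes y :: real
  assumes "0 \<le> y"
  shows "(\<Sum>k<n. y ^ k / fact k) \<le> exp y"
proof -
  have "(\<Sum>k<n. y ^ k /\<^sub>R fact k) \<le> (\<Sum>k. y ^ k /\<^sub>R fact k)"
    using assms by (intro sum_le_suminf) (auto simp: summable_exp)
  then show ?thesis
    by (simp add: exp_def divide_inverse mult.commute)
qed

text \<open>The partial sums of the exponential series are dominated by
  \<open>exp (\<bar>t\<bar> * \<bar>x\<bar>)\<close>, so limit and integral commute. Hence the
  moments determine the characteristic function.\<close>

lemma char_eq_moment_limit:
  assumes [measurable_cong]: "sets M = sets borel" and "has_moments M" and "exp_integrable M"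
  shows "(\<lambda>n. \<Sum>k<n. (\<i> * t) ^ k / fact k * of_real (moment M k)) \<longlonglongrightarrow> char M t"
proof -
  note int = has_moments_integrable_power[OF assms(1,2)]
  have term_eq: "(\<i> * t * of_real x) ^ k / fact k = (\<i> * t) ^ k / fact k * of_real (x ^ k)" for x :: real and k
    by (simp add: power_mult_distrib)
  have "(\<integral>x. (\<Sum>k<n. (\<i> * t * of_real x) ^ k / fact k) \<partial>M)
      = (\<Sum>k<n. (\<i> * t) ^ k / fact k * of_real (moment M k))" for n
    unfolding term_eq moment_def
    by (subst Bochner_Integration.integral_sum)
       (auto simp: int intro!: integrable_mult_right integrable_of_real simp del: of_real_power)
  moreover have "(\<lambda>n. \<integral>x. (\<Sum>k<n. (\<i> * t * of_real x) ^ k / fact k) \<partial>M) \<longlonglongrightarrow> (\<integral>x. iexp (t * x) \<partial>M)"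
  proof (rule integral_dominated_convergence)
    show "integrable M (\<lambda>x. exp (\<bar>t\<bar> * \<bar>x\<bar>))"
      using assms(3) by (simp add: exp_integrable_def)
    show "AE x in M. (\<lambda>n. \<Sum>k<n. (\<i> * t * of_real x) ^ k / fact k) \<longlonglongrightarrow> iexp (t * x)"
      using exp_converges[of "\<i> * t * complex_of_real x" for x]
      by (simp add: sums_def scaleR_conv_of_real divide_inverse mult.commute mult.left_commute)
    show "AE x in M. norm (\<Sum>k<n. (\<i> * t * of_real x) ^ k / fact k) \<le> exp (\<bar>t\<bar> * \<bar>x\<bar>)" for n
    proof (rule AE_I2)
      fix x :: real
      have "norm (\<Sum>k<n. (\<i> * t * of_real x) ^ k / fact k) \<le> (\<Sum>k<n. (\<bar>t\<bar> * \<bar>x\<bar>) ^ k / fact k)"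
        by (rule sum_norm_le) (simp add: norm_divide norm_power norm_mult)
      also have "\<dots> \<le> exp (\<bar>t\<bar> * \<bar>x\<bar>)"
        by (rule sum_power_fact_le_exp) simp
      finally show "norm (\<Sum>k<n. (\<i> * t * of_real x) ^ k / fact k) \<le> exp (\<bar>t\<bar> * \<bar>x\<bar>)" .
    qed
  qed measurable
  ultimately show ?thesis
    by (simp add: char_def)
qed

text \<open>Levy's theorem speaks of probability distributions. The characteristic function at
  \<open>0\<close> is the total mass, so both measures are normalised by the same \<open>q\<close>;
  mass zero is treated apart.\<close>

lemma finite_measure_eqI_char:
  fixes M N :: "real measure"
  assumes "finite_measure M" "finite_measure N"
    and sets [measurable_cong]: "sets M = sets borel" "sets N = sets borel"
    and char: "char M = char N"
  shows "M = N"
proof -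
  interpret M: finite_measure M by fact
  interpret N: finite_measure N by fact
  have space: "space M = UNIV" "space N = UNIV"
    using sets by (auto dest: sets_eq_imp_space_eq)
  define q where "q = measure M UNIV"
  have q: "measure N UNIV = q"
    using fun_cong[OF char, of 0] by (simp add: char_def q_def space)
  have "q \<ge> 0" by (simp add: q_def)
  have emM: "emeasure M UNIV = ennreal q" and emN: "emeasure N UNIV = ennreal q"
    by (simp_all add: q_def M.emeasure_eq_measure N.emeasure_eq_measure q[symmetric])
       (simp_all add: q q_def)
  show ?thesis
  proof (cases "q = 0")
    case True
    then have "emeasure M A = 0" "emeasure N A = 0" if "A \<in> sets borel" for A
      using that emM emN sets by (auto intro: emeasure_eq_0)
    then show ?thesis
      using sets by (intro measure_eqI) auto
  next
    case False
    with \<open>q \<ge> 0\<close> have "q > 0" by simp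
    define P where "P K = density K (\<lambda>_. ennreal (1 / q))" for K :: "real measure"
    have dist: "real_distribution (P K)"
      if "sets K = sets borel" "emeasure K UNIV = ennreal q" for K :: "real measure"
    proof -
      have "prob_space (P K)"
        using that \<open>q > 0\<close>
        by (intro prob_spaceI)
          (auto simp: P_def emeasure_density_const sets_eq_imp_space_eq[of K borel] simp flip: ennreal_mult)
      then show ?thesis
        using that by (auto simp: real_distribution_def real_distribution_axioms_def P_def)
    qed
    have charP: "char (P K) = (\<lambda>t. char K t / q)" if [measurable_cong]: "sets K = sets borel" for K :: "real measure"
      using \<open>q > 0\<close> by (intro ext) (simp add: char_def P_def integral_density scaleR_conv_of_real divide_inverse mult.commute)
    have "P M = P N"
      by (rule Levy_uniqueness) (auto simp: dist charP sets emM emN char)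
    have "emeasure M A = emeasure N A" if "A \<in> sets borel" for A
    proof -
      have "emeasure (P M) A = emeasure (P N) A" by (simp add: \<open>P M = P N\<close>)
      then have "ennreal (1 / q) * emeasure M A = ennreal (1 / q) * emeasure N A"
        using that sets by (simp add: P_def emeasure_density_const)
      then show ?thesis
        using \<open>q > 0\<close> by (simp add: ennreal_mult_cancel_left)
    qed
    then show ?thesis
      using sets by (intro measure_eqI) auto
  qed
qed

lemma determinate_if_moment_growth:
  assumes M: "sets M = sets borel" "has_moments M"
    and growth: "(\<lambda>n. root (2 * n) (moment M (2 * n))) \<in> o(\<lambda>n. real n)"
  shows "determinate M"
  unfolding determinate_def
proof safe
  fix N :: "real measure"
  assume N: "sets N = sets borel" "has_moments N" and eq: "\<forall>n. moment N n = moment M n"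
  \<comment> \<open>The growth condition concerns the moments alone, so the competitor
    \<open>N\<close> inherits it.\<close>
  have "exp_integrable M" "exp_integrable N"
    using M N growth by (simp_all add: exp_integrable_if_moment_growth eq)
  then have "char N t = char M t" for t
    using char_eq_moment_limit[OF N, of t] char_eq_moment_limit[OF M, of t] 
    by (auto simp: eq intro: LIMSEQ_unique)
  then show "N = M"
    using M N by (intro finite_measure_eqI_char has_moments_finite_measure ext)
qed

section \<open>Entire functions with controlled Taylor coefficients\<close>

text \<open>
  The bound \<open>B\<close> is on the \<open>\<ell>\<^sup>1\<close> norm of the Taylor coefficients: it controls their \<open>\<ell>\<^sup>2\<close> norm
  and, unlike that norm, is submultiplicative under products of functions. The growth condition
  on the coefficients makes the Taylor series converge in \<open>L\<^sup>2(M)\<close>.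
\<close>

definition majorized :: "(real \<Rightarrow> real) \<Rightarrow> real \<Rightarrow> bool" where
  "majorized \<phi> B \<longleftrightarrow> (\<exists>g C r. 0 \<le> r \<and> (\<forall>n. \<bar>g n\<bar> \<le> C * r ^ n / fact n) \<and>
    (\<forall>x. (\<lambda>n. g n * x ^ n) sums \<phi> x) \<and> (\<Sum>n. \<bar>g n\<bar>) \<le> B)"

lemma abs_summable_power_series:
  fixes g :: "nat \<Rightarrow> real"
  assumes "\<And>n. \<bar>g n\<bar> \<le> C * r ^ n / fact n"
  shows "summable (\<lambda>n. \<bar>g n * x ^ n\<bar>)"
proof (rule summable_comparison_test')
  show "summable (\<lambda>n. C * (inverse (fact n) * (r * \<bar>x\<bar>) ^ n))"
    by (intro summable_mult summable_exp)
  show "norm \<bar>g n * x ^ n\<bar> \<le> C * (inverse (fact n) * (r * \<bar>x\<bar>) ^ n)" for n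
    using mult_right_mono[OF assms[of n], of "\<bar>x\<bar> ^ n"]
    by (simp add: abs_mult power_abs power_mult_distrib field_simps)
qed

lemma abs_summable_coeff:
  fixes g :: "nat \<Rightarrow> real"
  assumes "\<And>n. \<bar>g n\<bar> \<le> C * r ^ n / fact n"
  shows "summable (\<lambda>n. \<bar>g n\<bar>)"
  using abs_summable_power_series[where x = 1, OF assms] by simp

lemma abs_partial_sum_le:
  fixes g :: "nat \<Rightarrow> real"
  assumes g: "\<And>n. \<bar>g n\<bar> \<le> C * r ^ n / fact n" and "0 \<le> r"
  shows "\<bar>\<Sum>k<n. g k * x ^ k\<bar> \<le> C * exp (r * \<bar>x\<bar>)"
proof -
  have "0 \<le> C"
    using g[of 0] by simp
  have "\<bar>\<Sum>k<n. g k * x ^ k\<bar> \<le> (\<Sum>k<n. C * ((r * \<bar>x\<bar>) ^ k / fact k))"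
  proof (rule order_trans[OF sum_abs], rule sum_mono)
    show "\<bar>g k * x ^ k\<bar> \<le> C * ((r * \<bar>x\<bar>) ^ k / fact k)" for k
      using mult_right_mono[OF g[of k], of "\<bar>x\<bar> ^ k"]
      by (simp add: abs_mult power_abs power_mult_distrib field_simps)
  qed
  also have "\<dots> = C * (\<Sum>k<n. (r * \<bar>x\<bar>) ^ k / fact k)"
    by (simp add: sum_distrib_left)
  also have "\<dots> \<le> C * exp (r * \<bar>x\<bar>)"
    using \<open>0 \<le> C\<close> \<open>0 \<le> r\<close> by (intro mult_left_mono sum_power_fact_le_exp) auto
  finally show ?thesis .
qed

lemma majorized_const: "majorized (\<lambda>_. c) \<bar>c\<bar>"
proof -
  define g where "g n = (if n = 0 then c else 0)" for n :: nat
  have "\<bar>g n\<bar> \<le> \<bar>c\<bar> * 1 ^ n / fact n" for n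
    by (simp add: g_def)
  moreover have "(\<lambda>n. g n * x ^ n) sums c" for x
    using sums_single[of 0 "\<lambda>_. c"] by (rule sums_cong[THEN iffD1, rotated]) (simp add: g_def)
  moreover have "(\<Sum>n. \<bar>g n\<bar>) \<le> \<bar>c\<bar>"
    by (subst suminf_finite[of "{0}"]) (auto simp: g_def)
  ultimately show ?thesis
    unfolding majorized_def by (metis zero_le_one)
qed

lemma majorized_lincomb:
  assumes "majorized \<phi> B" "majorized \<psi> D"
  shows "majorized (\<lambda>x. a * \<phi> x + b * \<psi> x) (\<bar>a\<bar> * B + \<bar>b\<bar> * D)"
proof -
  from assms(1) obtain g C r where g: "0 \<le> r" "\<And>n. \<bar>g n\<bar> \<le> C * r ^ n / fact n"
    "\<And>x. (\<lambda>n. g n * x ^ n) sums \<phi> x" "(\<Sum>n. \<bar>g n\<bar>) \<le> B"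
    by (auto simp: majorized_def)
  from assms(2) obtain h E s where h: "0 \<le> s" "\<And>n. \<bar>h n\<bar> \<le> E * s ^ n / fact n"
    "\<And>x. (\<lambda>n. h n * x ^ n) sums \<psi> x" "(\<Sum>n. \<bar>h n\<bar>) \<le> D"
    by (auto simp: majorized_def)
  have "0 \<le> C" "0 \<le> E"
    using g(2)[of 0] h(2)[of 0] by auto
  define k where "k n = a * g n + b * h n" for n
  have k_le: "\<bar>k n\<bar> \<le> \<bar>a\<bar> * \<bar>g n\<bar> + \<bar>b\<bar> * \<bar>h n\<bar>" for n
    unfolding k_def by (rule order_trans[OF abs_triangle_ineq]) (simp add: abs_mult)
  have bound: "\<bar>k n\<bar> \<le> (\<bar>a\<bar> * C + \<bar>b\<bar> * E) * max r s ^ n / fact n" for n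
  proof -
    have "\<bar>g n\<bar> \<le> C * max r s ^ n / fact n"
      using g(1,2) \<open>0 \<le> C\<close> by (intro order_trans[OF g(2)] divide_right_mono mult_left_mono power_mono) auto
    moreover have "\<bar>h n\<bar> \<le> E * max r s ^ n / fact n"
      using h(1,2) \<open>0 \<le> E\<close> by (intro order_trans[OF h(2)] divide_right_mono mult_left_mono power_mono) auto
    ultimately have "\<bar>k n\<bar> \<le> \<bar>a\<bar> * (C * max r s ^ n / fact n) + \<bar>b\<bar> * (E * max r s ^ n / fact n)"
      by (intro order_trans[OF k_le] add_mono mult_left_mono) auto
    then show ?thesis
      by (simp add: algebra_simps add_divide_distrib)
  qed
  moreover have "(\<lambda>n. k n * x ^ n) sums (a * \<phi> x + b * \<psi> x)" for x
    using sums_add[OF sums_mult[OF g(3)[of x], of a] sums_mult[OF h(3)[of x], of b]]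
    by (simp add: k_def algebra_simps)
  moreover have "(\<Sum>n. \<bar>k n\<bar>) \<le> \<bar>a\<bar> * B + \<bar>b\<bar> * D"
  proof -
    have sg: "summable (\<lambda>n. \<bar>g n\<bar>)" and sh: "summable (\<lambda>n. \<bar>h n\<bar>)"
      using g(2) h(2) by (blast intro: abs_summable_coeff)+
    have "(\<Sum>n. \<bar>k n\<bar>) \<le> (\<Sum>n. \<bar>a\<bar> * \<bar>g n\<bar> + \<bar>b\<bar> * \<bar>h n\<bar>)"
      by (intro suminf_le k_le summable_add summable_mult sg sh abs_summable_coeff[OF bound])
    also have "\<dots> = \<bar>a\<bar> * (\<Sum>n. \<bar>g n\<bar>) + \<bar>b\<bar> * (\<Sum>n. \<bar>h n\<bar>)"
      using sg sh by (simp add: suminf_add[symmetric] suminf_mult summable_mult)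
    also have "\<dots> \<le> \<bar>a\<bar> * B + \<bar>b\<bar> * D"
      using g(4) h(4) by (intro add_mono mult_left_mono) auto
    finally show ?thesis .
  qed
  moreover have "0 \<le> max r s"
    using g(1) by simp
  ultimately show ?thesis
    unfolding majorized_def by blast
qed

text \<open>The Cauchy product gives the coefficients. The binomial theorem merges the two factorial
  bounds into one with rate \<open>r + s\<close>, and the l^1 norm is submultiplicative under
  convolution.\<close>

lemma majorized_mult:
  assumes "majorized \<phi> B" "majorized \<psi> D"
  shows "majorized (\<lambda>x. \<phi> x * \<psi> x) (B * D)"
proof -
  from assms(1) obtain g C r where g: "0 \<le> r" "\<And>n. \<bar>g n\<bar> \<le> C * r ^ n / fact n"
    "\<And>x. (\<lambda>n. g n * x ^ n) sums \<phi> x" "(\<Sum>n. \<bar>g n\<bar>) \<le> B"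
    by (auto simp: majorized_def)
  from assms(2) obtain h E s where h: "0 \<le> s" "\<And>n. \<bar>h n\<bar> \<le> E * s ^ n / fact n"
    "\<And>x. (\<lambda>n. h n * x ^ n) sums \<psi> x" "(\<Sum>n. \<bar>h n\<bar>) \<le> D"
    by (auto simp: majorized_def)
  define k where "k n = (\<Sum>i\<le>n. g i * h (n - i))" for n
  have k_le: "\<bar>k n\<bar> \<le> (\<Sum>i\<le>n. \<bar>g i\<bar> * \<bar>h (n - i)\<bar>)" for n
    unfolding k_def by (rule order_trans[OF sum_abs]) (simp add: abs_mult)
  have bound: "\<bar>k n\<bar> \<le> (C * E) * (r + s) ^ n / fact n" for n
  proof -
    have "\<bar>k n\<bar> \<le> (\<Sum>i\<le>n. (C * r ^ i / fact i) * (E * s ^ (n - i) / fact (n - i)))"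
      by (intro order_trans[OF k_le] sum_mono mult_mono g h order_trans[OF abs_ge_zero g(2)]) auto
    also have "\<dots> = (\<Sum>i\<le>n. C * E / fact n * (of_nat (n choose i) * r ^ i * s ^ (n - i)))"
      by (intro sum.cong refl) (simp add: binomial_fact)
    also have "\<dots> = C * E / fact n * (r + s) ^ n"
      by (simp only: binomial_ring sum_distrib_left)
    finally show ?thesis by simp
  qed
  moreover have "(\<lambda>n. k n * x ^ n) sums (\<phi> x * \<psi> x)" for x
  proof -
    have "(\<lambda>n. \<Sum>i\<le>n. (g i * x ^ i) * (h (n - i) * x ^ (n - i))) sums ((\<Sum>n. g n * x ^ n) * (\<Sum>n. h n * x ^ n))"
      by (rule Cauchy_product_sums) (use abs_summable_power_series[of g C r x] abs_summable_power_series[of h E s x] g(2) h(2) in \<open>simp_all only: real_norm_def\<close>)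
    moreover have "(\<Sum>i\<le>n. (g i * x ^ i) * (h (n - i) * x ^ (n - i))) = k n * x ^ n" for n
      unfolding k_def sum_distrib_right by (intro sum.cong refl) (simp add: algebra_simps flip: power_add)
    ultimately show ?thesis
      using g(3)[of x] h(3)[of x] by (simp add: sums_iff)
  qed
  moreover have "(\<Sum>n. \<bar>k n\<bar>) \<le> B * D"
  proof -
    have sg: "summable (\<lambda>n. \<bar>g n\<bar>)" and sh: "summable (\<lambda>n. \<bar>h n\<bar>)"
      using g(2) h(2) by (blast intro: abs_summable_coeff)+
    have prod: "(\<lambda>n. \<Sum>i\<le>n. \<bar>g i\<bar> * \<bar>h (n - i)\<bar>) sums ((\<Sum>n. \<bar>g n\<bar>) * (\<Sum>n. \<bar>h n\<bar>))"
      using sg sh by (intro Cauchy_product_sums) auto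
    have "(\<Sum>n. \<bar>k n\<bar>) \<le> (\<Sum>n. \<Sum>i\<le>n. \<bar>g i\<bar> * \<bar>h (n - i)\<bar>)"
      by (intro suminf_le k_le abs_summable_coeff[OF bound] sums_summable[OF prod])
    also have "\<dots> = (\<Sum>n. \<bar>g n\<bar>) * (\<Sum>n. \<bar>h n\<bar>)"
      using prod by (rule sums_unique[symmetric])
    also have "\<dots> \<le> B * D"
      using g(4) h(4) by (intro mult_mono suminf_nonneg sg sh order_trans[OF suminf_nonneg[OF sg] g(4)]) auto
    finally show ?thesis .
  qed
  moreover have "0 \<le> r + s"
    using g(1) h(1) by simp
  ultimately show ?thesis
    unfolding majorized_def by blast
qed

lemma majorized_power:
  assumes "majorized \<phi> B"
  shows "majorized (\<lambda>x. \<phi> x ^ n) (B ^ n)"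
proof (induction n)
  case 0
  then show ?case using majorized_const[of 1] by simp
next
  case (Suc n)
  then show ?case using majorized_mult[OF assms] by simp
qed

text \<open>With v_n = 1 - (1 - u)^n one has v_(n+1) = u + v_n - u v_n. The bounds obey the same
  recursion with a plus sign, solved by (1 + B)^n - 1. In this form the constant terms cancel, so
  the bound is small when \<open>B\<close> is.\<close>

lemma majorized_one_minus_power:
  assumes "majorized u B"
  shows "majorized (\<lambda>x. 1 - (1 - u x) ^ n) ((1 + B) ^ n - 1)"
proof (induction n)
  case 0
  then show ?case using majorized_const[of 0] by simp
next
  case (Suc n)
  let ?v = "\<lambda>x. 1 - (1 - u x) ^ n"
  have "majorized (\<lambda>x. 1 * (1 * u x + 1 * ?v x) + (-1) * (u x * ?v x))
    (\<bar>1\<bar> * (\<bar>1\<bar> * B + \<bar>1\<bar> * ((1 + B) ^ n - 1)) + \<bar>-1\<bar> * (B * ((1 + B) ^ n - 1)))"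
    by (intro majorized_lincomb majorized_mult assms Suc)
  then show ?case
    by (simp add: algebra_simps)
qed

text \<open>Taking absolute values of the coefficients turns the cosine series into that of
  \<open>cosh\<close>; the constant term is removed in both.\<close>

lemma majorized_one_minus_cos:
  assumes "0 \<le> a"
  shows "majorized (\<lambda>x. (1 - cos (a * x)) / 2) ((cosh a - 1) / 2)"
proof -
  define g where "g n = (if n = 0 then 0 else - (cos_coeff n * a ^ n) / 2)" for n
  have abs_coeff: "\<bar>cos_coeff n\<bar> = (if even n then 1 / fact n else 0)" for n
    by (simp add: cos_coeff_def)
  have "\<bar>g n\<bar> \<le> 1 * a ^ n / fact n" for n
    using assms by (auto simp: g_def abs_mult abs_coeff divide_simps)
  moreover have "(\<lambda>n. g n * x ^ n) sums ((1 - cos (a * x)) / 2)" for x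
    using sums_divide[OF sums_diff[OF sums_single[of 0 "\<lambda>_. 1"] cos_converges[of "a * x"]], of 2]
    by (rule sums_cong[THEN iffD1, rotated]) (simp add: g_def power_mult_distrib)
  moreover have "(\<lambda>n. \<bar>g n\<bar>) sums ((cosh a - 1) / 2)"
    using sums_divide[OF sums_diff[OF cosh_converges[of a] sums_single[of 0 "\<lambda>_. 1"]], of 2]
    by (rule sums_cong[THEN iffD1, rotated]) (use assms in \<open>auto simp: g_def abs_mult abs_coeff field_simps\<close>)
  then have "(\<Sum>n. \<bar>g n\<bar>) \<le> (cosh a - 1) / 2"
    by (simp add: sums_iff)
  ultimately show ?thesis
    using assms unfolding majorized_def by blast
qed

section \<open>Closability along polynomials and entire functions\<close>

text \<open>Closability in real form: the operator sends coefficients to polynomials, so an L^2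
  limit \<open>h\<close> vanishes once the coefficients tend to zero in l^2. Being bounded,
  \<open>h\<close> lies in \<open>L2 M\<close> for finite \<open>M\<close>.\<close>

lemma closable_polynomial_limit:
  fixes M :: "real measure" and h :: "real \<Rightarrow> real"
  assumes M: "finite_measure M" and [measurable_cong]: "sets M = sets borel"
    and closable: "closable_on fin_seqs M power_series_op"
    and [measurable]: "h \<in> borel_measurable borel" and h_le: "\<And>x. \<bar>h x\<bar> \<le> 1"
    and coeffs: "(\<lambda>m. \<Sum>n<N m. (G m n)\<^sup>2) \<longlonglongrightarrow> 0"
    and lim: "(\<lambda>m. \<integral>x. ((\<Sum>n<N m. G m n * x ^ n) - h x)\<^sup>2 \<partial>M) \<longlonglongrightarrow> 0"
  shows "AE x in M. h x = 0"
proof -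
  interpret finite_measure M by fact
  define g where "g m n = complex_of_real (if n < N m then G m n else 0)" for m n
  have supp: "{n. g m n \<noteq> 0} \<subseteq> {..<N m}" for m
    by (auto simp: g_def split: if_splits)
  have "g m \<in> fin_seqs" for m
    unfolding fin_seqs_def using supp finite_subset by blast
  moreover have "(\<lambda>x. complex_of_real (h x)) \<in> L2 M"
    unfolding L2_def
    by (auto intro!: integrable_const_bound[where B = 1] simp: abs_square_le_1 h_le)
  moreover have "(\<lambda>m. ell2_norm (g m)) \<longlonglongrightarrow> 0"
  proof -
    have "ell2_norm (g m) = sqrt (\<Sum>n<N m. (G m n)\<^sup>2)" for m
    proof -
      have "(\<Sum>n. (cmod (g m n))\<^sup>2) = (\<Sum>n<N m. (cmod (g m n))\<^sup>2)"
        by (rule suminf_finite) (auto simp: g_def)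
      then show ?thesis
        by (simp add: ell2_norm_def g_def)
    qed
    then show ?thesis
      using tendsto_real_sqrt[OF coeffs] by simp
  qed
  moreover have "(\<lambda>m. L2_norm M (\<lambda>x. power_series_op (g m) x - complex_of_real (h x))) \<longlonglongrightarrow> 0"
  proof -
    have "(cmod (power_series_op (g m) x - complex_of_real (h x)))\<^sup>2 = ((\<Sum>n<N m. G m n * x ^ n) - h x)\<^sup>2" for m x
    proof -
      have "power_series_op (g m) x = (\<Sum>n<N m. g m n * of_real x ^ n)"
        unfolding power_series_op_def by (rule sum.mono_neutral_left) (use supp[of m] in auto)
      also have "\<dots> = complex_of_real (\<Sum>n<N m. G m n * x ^ n)"
        by (simp add: g_def)
      finally show ?thesis
        by (simp only: of_real_diff[symmetric] norm_of_real power2_abs)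
    qed
    then show ?thesis
      using tendsto_real_sqrt[OF lim] by (simp add: L2_norm_def)
  qed
  ultimately have "AE x in M. complex_of_real (h x) = 0"
    using closable unfolding closable_on_def by blast
  then show ?thesis
    by simp
qed

lemma majorized_measurable [measurable_dest]:
  assumes "majorized \<phi> B"
  shows "\<phi> \<in> borel_measurable borel"
proof -
  from assms obtain g where g: "\<And>x. (\<lambda>n. g n * x ^ n) sums \<phi> x"
    unfolding majorized_def by blast
  show ?thesis
  proof (rule borel_measurable_LIMSEQ_real)
    show "(\<lambda>n. \<Sum>k<n. g k * x ^ k) \<longlonglongrightarrow> \<phi> x" for x
      using g[of x] by (simp only: sums_def)
    show "(\<lambda>x. \<Sum>k<n. g k * x ^ k) \<in> borel_measurable borel" for n
      by measurable
  qed
qed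

text \<open>Taylor polynomials serve: domination by \<open>C * exp (r * \<bar>x\<bar>)\<close> gives
  convergence in L^2(M), and the l^2 norm of the truncated coefficients is at most their l^1 norm.
  Integrability is recorded because the integral of a non-integrable function is \<open>0\<close>,
  which would make the last bound empty.\<close>

lemma majorized_approx_polynomial:
  assumes [measurable_cong]: "sets M = sets borel" and M: "exp_integrable M"
    and \<phi>: "majorized \<phi> B" and "e > 0"
  obtains N G where "(\<Sum>n<N. (G n)\<^sup>2) \<le> B\<^sup>2"
    "integrable M (\<lambda>x. ((\<Sum>n<N. G n * x ^ n) - \<phi> x)\<^sup>2)"
    "(\<integral>x. ((\<Sum>n<N. G n * x ^ n) - \<phi> x)\<^sup>2 \<partial>M) < e"
proof -
  note [measurable] = majorized_measurable[OF \<phi>]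
  from \<phi> obtain g C r where g: "0 \<le> r" "\<And>n. \<bar>g n\<bar> \<le> C * r ^ n / fact n"
    "\<And>x. (\<lambda>n. g n * x ^ n) sums \<phi> x" "(\<Sum>n. \<bar>g n\<bar>) \<le> B"
    by (auto simp: majorized_def)
  define P where "P N x = (\<Sum>n<N. g n * x ^ n)" for N x
  have [measurable]: "P N \<in> borel_measurable borel" for N
    unfolding P_def by measurable
  have lim: "(\<lambda>N. P N x) \<longlonglongrightarrow> \<phi> x" for x
    using g(3)[of x] by (simp add: sums_def P_def)
  have P_le: "\<bar>P N x\<bar> \<le> C * exp (r * \<bar>x\<bar>)" for N x
    unfolding P_def using g(1,2) by (intro abs_partial_sum_le)
  have \<phi>_le: "\<bar>\<phi> x\<bar> \<le> C * exp (r * \<bar>x\<bar>)" for x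
    using tendsto_rabs[OF lim[of x]] P_le by (intro LIMSEQ_le_const2) auto
  have "(P N x - \<phi> x)\<^sup>2 \<le> 4 * C\<^sup>2 * exp (2 * r * \<bar>x\<bar>)" for N x
  proof -
    have "\<bar>P N x - \<phi> x\<bar> \<le> 2 * C * exp (r * \<bar>x\<bar>)"
      using P_le[of N x] \<phi>_le[of x] by linarith
    then have "\<bar>P N x - \<phi> x\<bar>\<^sup>2 \<le> (2 * C * exp (r * \<bar>x\<bar>))\<^sup>2"
      by (intro power_mono) auto
    also have "\<dots> = 4 * C\<^sup>2 * exp (2 * r * \<bar>x\<bar>)"
      by (simp add: power_mult_distrib mult.assoc flip: exp_double)
    finally show ?thesis
      by simp
  qed
  then have bound: "AE x in M. norm ((P N x - \<phi> x)\<^sup>2) \<le> 4 * C\<^sup>2 * exp (2 * r * \<bar>x\<bar>)" for N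
    by simp
  have int: "integrable M (\<lambda>x. 4 * C\<^sup>2 * exp (2 * r * \<bar>x\<bar>))"
    using M by (intro integrable_mult_right) (simp add: exp_integrable_def)
  have lim0: "AE x in M. (\<lambda>N. (P N x - \<phi> x)\<^sup>2) \<longlonglongrightarrow> 0"
  proof (rule AE_I2)
    show "(\<lambda>N. (P N x - \<phi> x)\<^sup>2) \<longlonglongrightarrow> 0" for x
      using tendsto_power[OF tendsto_diff[OF lim[of x] tendsto_const[of "\<phi> x"]], of 2] by simp
  qed
  have "(\<lambda>N. \<integral>x. (P N x - \<phi> x)\<^sup>2 \<partial>M) \<longlonglongrightarrow> (\<integral>x. 0 \<partial>M)"
    by (rule integral_dominated_convergence[OF _ _ int lim0 bound]) measurable
  then have "\<forall>\<^sub>F N in sequentially. (\<integral>x. (P N x - \<phi> x)\<^sup>2 \<partial>M) < e"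
    using \<open>e > 0\<close> by (intro order_tendstoD) auto
  then obtain N where "(\<integral>x. (P N x - \<phi> x)\<^sup>2 \<partial>M) < e"
    by (auto simp: eventually_sequentially)
  moreover have "integrable M (\<lambda>x. (P N x - \<phi> x)\<^sup>2)"
    using bound[of N] by (intro Bochner_Integration.integrable_bound[OF int]) auto
  moreover have "(\<Sum>n<N. (g n)\<^sup>2) \<le> B\<^sup>2"
  proof -
    have "L2_set g {..<N} \<le> (\<Sum>n<N. \<bar>g n\<bar>)"
      by (rule L2_set_le_sum_abs)
    also have "\<dots> \<le> (\<Sum>n. \<bar>g n\<bar>)"
      using abs_summable_coeff[OF g(2)] by (intro sum_le_suminf) auto
    also note g(4)
    finally have "(L2_set g {..<N})\<^sup>2 \<le> B\<^sup>2"
      by (intro power_mono) (auto simp: L2_set_nonneg)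
    then show ?thesis
      by (simp add: L2_set_def sum_nonneg)
  qed
  ultimately show thesis
    using that unfolding P_def by blast
qed

text \<open>A diagonal choice: \<open>\<phi> m\<close> is replaced by a Taylor polynomial at squared
  distance below 1 / (m + 1), with l^2 norm of the coefficients still bounded by \<open>B m\<close>.
  Bounded convergence on the finite measure handles the distance from \<open>\<phi> m\<close> to
  \<open>h\<close>.\<close>

lemma closable_majorized_limit:
  fixes M :: "real measure" and h :: "real \<Rightarrow> real"
  assumes M: "finite_measure M" "exp_integrable M" and sets [measurable_cong]: "sets M = sets borel"
    and closable: "closable_on fin_seqs M power_series_op"
    and [measurable]: "h \<in> borel_measurable borel" and h_le: "\<And>x. \<bar>h x\<bar> \<le> 1"
    and \<phi>: "\<And>m. majorized (\<phi> m) (B m)" and \<phi>_le: "\<And>m x. \<bar>\<phi> m x\<bar> \<le> 1"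
    and lim: "\<And>x. (\<lambda>m. \<phi> m x) \<longlonglongrightarrow> h x" and B: "B \<longlonglongrightarrow> 0"
  shows "AE x in M. h x = 0"
proof -
  interpret finite_measure M by fact
  note [measurable] = majorized_measurable[OF \<phi>]
  have "\<exists>N G. (\<Sum>n<N. (G n)\<^sup>2) \<le> (B m)\<^sup>2 \<and>
    integrable M (\<lambda>x. ((\<Sum>n<N. G n * x ^ n) - \<phi> m x)\<^sup>2) \<and>
    (\<integral>x. ((\<Sum>n<N. G n * x ^ n) - \<phi> m x)\<^sup>2 \<partial>M) < 1 / real (Suc m)" for m
    by (rule majorized_approx_polynomial[OF sets M(2) \<phi>, of "1 / real (Suc m)" m]) auto
  then have "\<forall>m. \<exists>N G. (\<Sum>n<N. (G n)\<^sup>2) \<le> (B m)\<^sup>2 \<and>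
    integrable M (\<lambda>x. ((\<Sum>n<N. G n * x ^ n) - \<phi> m x)\<^sup>2) \<and>
    (\<integral>x. ((\<Sum>n<N. G n * x ^ n) - \<phi> m x)\<^sup>2 \<partial>M) < 1 / real (Suc m)"
    by (rule allI)
  from choice[OF this] obtain N where "\<forall>m. \<exists>G. (\<Sum>n<N m. (G n)\<^sup>2) \<le> (B m)\<^sup>2 \<and>
    integrable M (\<lambda>x. ((\<Sum>n<N m. G n * x ^ n) - \<phi> m x)\<^sup>2) \<and>
    (\<integral>x. ((\<Sum>n<N m. G n * x ^ n) - \<phi> m x)\<^sup>2 \<partial>M) < 1 / real (Suc m)" ..
  from choice[OF this] obtain G where "\<forall>m. (\<Sum>n<N m. (G m n)\<^sup>2) \<le> (B m)\<^sup>2 \<and>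
    integrable M (\<lambda>x. ((\<Sum>n<N m. G m n * x ^ n) - \<phi> m x)\<^sup>2) \<and>
    (\<integral>x. ((\<Sum>n<N m. G m n * x ^ n) - \<phi> m x)\<^sup>2 \<partial>M) < 1 / real (Suc m)" ..
  then have G: "(\<Sum>n<N m. (G m n)\<^sup>2) \<le> (B m)\<^sup>2"
    "integrable M (\<lambda>x. ((\<Sum>n<N m. G m n * x ^ n) - \<phi> m x)\<^sup>2)"
    "(\<integral>x. ((\<Sum>n<N m. G m n * x ^ n) - \<phi> m x)\<^sup>2 \<partial>M) < 1 / real (Suc m)" for m
    by blast+
  define P where "P m x = (\<Sum>n<N m. G m n * x ^ n)" for m x
  note P = G(2,3)[folded P_def]
  have diff_le: "(\<phi> m x - h x)\<^sup>2 \<le> 4" for m x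
  proof -
    have "\<bar>\<phi> m x - h x\<bar>\<^sup>2 \<le> 2\<^sup>2"
      using h_le[of x] \<phi>_le[of m x] by (intro power_mono) auto
    then show ?thesis by simp
  qed
  have int: "integrable M (\<lambda>x. (\<phi> m x - h x)\<^sup>2)" for m
    by (rule integrable_const_bound[where B = 4]) (use diff_le in auto)
  have lim0: "(\<lambda>m. \<integral>x. (\<phi> m x - h x)\<^sup>2 \<partial>M) \<longlonglongrightarrow> (\<integral>x. 0 \<partial>M)"
  proof (rule integral_dominated_convergence[where w = "\<lambda>_. 4"])
    show "AE x in M. (\<lambda>m. (\<phi> m x - h x)\<^sup>2) \<longlonglongrightarrow> 0"
    proof (rule AE_I2)
      show "(\<lambda>m. (\<phi> m x - h x)\<^sup>2) \<longlonglongrightarrow> 0" for x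
        using tendsto_power[OF tendsto_diff[OF lim[of x] tendsto_const[of "h x"]], of 2] by simp
    qed
  qed (use diff_le in auto)
  have "(\<lambda>m. \<integral>x. (P m x - h x)\<^sup>2 \<partial>M) \<longlonglongrightarrow> 0"
  proof (rule tendsto_sandwich[where f = "\<lambda>_. 0"])
    show "\<forall>\<^sub>F m in sequentially. (\<integral>x. (P m x - h x)\<^sup>2 \<partial>M) \<le>
      2 * (1 / real (Suc m)) + 2 * (\<integral>x. (\<phi> m x - h x)\<^sup>2 \<partial>M)"
    proof (intro always_eventually allI)
      fix m
      \<comment> \<open>This is (a + b)^2 \<le> 2 a^2 + 2 b^2, read off from (a - b)^2 \<ge>
        0.\<close>
      have "(P m x - h x)\<^sup>2 \<le> 2 * (P m x - \<phi> m x)\<^sup>2 + 2 * (\<phi> m x - h x)\<^sup>2" for x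
        using zero_le_power2[of "(P m x - \<phi> m x) - (\<phi> m x - h x)"] by (simp add: power2_eq_square algebra_simps)
      then have "(\<integral>x. (P m x - h x)\<^sup>2 \<partial>M) \<le> (\<integral>x. 2 * (P m x - \<phi> m x)\<^sup>2 + 2 * (\<phi> m x - h x)\<^sup>2 \<partial>M)"
        using P(1) int by (intro integral_mono') auto
      also have "\<dots> = 2 * (\<integral>x. (P m x - \<phi> m x)\<^sup>2 \<partial>M) + 2 * (\<integral>x. (\<phi> m x - h x)\<^sup>2 \<partial>M)"
        using P(1) int by simp
      also have "\<dots> \<le> 2 * (1 / real (Suc m)) + 2 * (\<integral>x. (\<phi> m x - h x)\<^sup>2 \<partial>M)"
        using P(2)[of m] by simp
      finally show "(\<integral>x. (P m x - h x)\<^sup>2 \<partial>M) \<le> 2 * (1 / real (Suc m)) + 2 * (\<integral>x. (\<phi> m x - h x)\<^sup>2 \<partial>M)" .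
    qed
    show "(\<lambda>m. 2 * (1 / real (Suc m)) + 2 * (\<integral>x. (\<phi> m x - h x)\<^sup>2 \<partial>M)) \<longlonglongrightarrow> 0"
      using tendsto_add[OF tendsto_mult_left[OF LIMSEQ_inverse_real_of_nat, of 2] tendsto_mult_left[OF lim0, of 2]]
      by (simp add: divide_inverse)
  qed (auto intro!: always_eventually)
  moreover have "(\<lambda>m. \<Sum>n<N m. (G m n)\<^sup>2) \<longlonglongrightarrow> 0"
  proof (rule tendsto_sandwich[where f = "\<lambda>_. 0"])
    show "(\<lambda>m. (B m)\<^sup>2) \<longlonglongrightarrow> 0"
      using tendsto_power[OF B, of 2] by simp
  qed (auto intro!: always_eventually sum_nonneg G(1))
  ultimately show ?thesis
    using closable_polynomial_limit[OF M(1) sets closable _ h_le, where N = N and G = G] by (simp add: P_def)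
qed

section \<open>Confining the measure to the closed interval [-1, 1]\<close>

text \<open>The exponent \<open>K m\<close> is tuned so that \<open>K m * y ^ m\<close> tends to
  zero for y < c and is at least \<open>m\<close> for y \<ge> c. Since r < c, the coefficient bounds
  vanish in the limit together with the functions on w < c, while the functions tend to
  \<open>1\<close> on w \<ge> c.\<close>

lemma closable_majorized_less:
  fixes M :: "real measure"
  assumes M: "finite_measure M" "exp_integrable M" and sets [measurable_cong]: "sets M = sets borel"
    and closable: "closable_on fin_seqs M power_series_op"
    and w: "majorized w r" "\<And>x. 0 \<le> w x" "\<And>x. w x \<le> 1" and r: "0 \<le> r" "r < c" and "c \<le> 1"
  shows "AE x in M. w x < c"
proof -
  note [measurable] = majorized_measurable[OF w(1)]
  have "0 < c" using r by simp
  text \<open>The factor \<open>m\<close> makes \<open>K m * y ^ m\<close> tend to infinity at \<open>y = c\<close> too, so that the limit is \<open>1\<close> there.\<close>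
  define K where "K m = nat \<lceil>real m / c ^ m\<rceil>" for m
  have K_ge: "real m / c ^ m \<le> real (K m)" and K_le: "real (K m) \<le> real m / c ^ m + 1" for m
    using \<open>0 < c\<close> unfolding K_def by (auto simp: of_nat_nat)
  \<comment> \<open>Rounding up in \<open>K\<close> costs the extra summand \<open>y ^ m\<close>,
    which tends to zero because y < c \<le> 1.\<close>
  have K_lim: "(\<lambda>m. real (K m) * y ^ m) \<longlonglongrightarrow> 0" if y: "0 \<le> y" "y < c" for y
  proof (rule tendsto_sandwich[where f = "\<lambda>_. 0"])
    have "(\<lambda>m. real m * (y / c) ^ m + y ^ m) \<longlonglongrightarrow> 0 + 0"
      using y \<open>c \<le> 1\<close> by (intro tendsto_add powser_times_n_limit_0 LIMSEQ_power_zero) auto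
    then show "(\<lambda>m. real m * (y / c) ^ m + y ^ m) \<longlonglongrightarrow> 0" by simp
    show "\<forall>\<^sub>F m in sequentially. real (K m) * y ^ m \<le> real m * (y / c) ^ m + y ^ m"
    proof (intro always_eventually allI)
      show "real (K m) * y ^ m \<le> real m * (y / c) ^ m + y ^ m" for m
        using mult_right_mono[OF K_le[of m], of "y ^ m"] y by (simp add: algebra_simps power_divide)
    qed
  qed (use y in auto)
  define \<phi> where "\<phi> m x = 1 - (1 - w x ^ m) ^ K m" for m x
  define h where "h x = (if w x < c then 0 else 1 :: real)" for x
  have pow: "0 \<le> w x ^ m" "w x ^ m \<le> 1" for x m
    using w(2,3)[of x] by (auto intro: power_le_one)
  have \<phi>_range: "0 \<le> \<phi> m x" "\<phi> m x \<le> 1" for m x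
    using pow[of x m] by (auto simp: \<phi>_def intro: power_le_one)
  have "AE x in M. h x = 0"
  proof (rule closable_majorized_limit[OF M sets closable])
    show "h \<in> borel_measurable borel"
      unfolding h_def by measurable
    show "\<bar>h x\<bar> \<le> 1" for x
      by (simp add: h_def)
    show "majorized (\<phi> m) ((1 + r ^ m) ^ K m - 1)" for m
      unfolding \<phi>_def by (intro majorized_one_minus_power majorized_power w)
    show "\<bar>\<phi> m x\<bar> \<le> 1" for m x
      using \<phi>_range[of m x] by simp
    show "(\<lambda>m. \<phi> m x) \<longlonglongrightarrow> h x" for x
    proof (cases "w x < c")
      case True
      have "\<phi> m x \<le> real (K m) * w x ^ m" for m
        using Bernoulli_inequality[of "- (w x ^ m)" "K m"] pow[of x m] by (simp add: \<phi>_def)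
      then have "(\<lambda>m. \<phi> m x) \<longlonglongrightarrow> 0"
        using \<phi>_range(1) by (intro tendsto_sandwich[OF _ _ tendsto_const K_lim[OF w(2) True]]) (auto intro!: always_eventually)
      then show ?thesis
        using True by (simp add: h_def)
    next
      case False
      \<comment> \<open>Here 1 - t \<le> exp (-t) is combined with \<open>K m * w x ^ m\<close>
        being at least \<open>m\<close>.\<close>
      have le: "(1 - w x ^ m) ^ K m \<le> exp (- real m)" for m
      proof -
        have "(1 - w x ^ m) ^ K m \<le> exp (- (w x ^ m)) ^ K m"
          using pow[of x m] exp_ge_add_one_self[of "- (w x ^ m)"] by (intro power_mono) auto
        also have "\<dots> = exp (- (real (K m) * w x ^ m))"
          by (simp flip: exp_of_nat_mult)
        also have "\<dots> \<le> exp (- real m)"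
        proof -
          have "real m = real m / c ^ m * c ^ m"
            using \<open>0 < c\<close> by simp
          also have "\<dots> \<le> real (K m) * w x ^ m"
            using K_ge[of m] False \<open>0 < c\<close> by (intro mult_mono power_mono) auto
          finally show ?thesis by simp
        qed
        finally show ?thesis .
      qed
      have nonneg: "0 \<le> (1 - w x ^ m) ^ K m" for m
        using \<phi>_range(2)[of m x] by (simp add: \<phi>_def)
      have "(\<lambda>m. exp (- real m)) \<longlonglongrightarrow> 0"
        by real_asymp
      from tendsto_sandwich[OF _ _ tendsto_const this]
      have "(\<lambda>m. (1 - w x ^ m) ^ K m) \<longlonglongrightarrow> 0"
        by (simp add: le nonneg)
      from tendsto_diff[OF tendsto_const[of 1] this] False show ?thesis
        by (simp add: \<phi>_def h_def)
    qed
    show "(\<lambda>m. (1 + r ^ m) ^ K m - 1) \<longlonglongrightarrow> 0"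
    proof (rule tendsto_sandwich[where f = "\<lambda>_. 0"])
      have "(1 + r ^ m) ^ K m \<le> exp (real (K m) * r ^ m)" for m
        using power_mono[OF exp_ge_add_one_self, of "r ^ m" "K m"] r by (simp add: exp_of_nat_mult)
      then show "\<forall>\<^sub>F m in sequentially. (1 + r ^ m) ^ K m - 1 \<le> exp (real (K m) * r ^ m) - 1"
        by simp
      have "(\<lambda>m. exp (real (K m) * r ^ m) - 1) \<longlonglongrightarrow> exp 0 - 1"
        by (intro tendsto_intros K_lim r)
      then show "(\<lambda>m. exp (real (K m) * r ^ m) - 1) \<longlonglongrightarrow> 0"
        by simp
    qed (use r in \<open>auto intro!: always_eventually one_le_power\<close>)
  qed
  then show ?thesis
    by eventually_elim (auto simp: h_def split: if_splits)
qed

text \<open>Both sides vanish to second order at t = 0: their difference, without the halves,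
  divided by t^2 tends to (x^2 - 1) / 2, which is positive for |x| > 1.\<close>

lemma one_minus_cos_gt_cosh_minus_one:
  fixes x :: real
  assumes "1 < \<bar>x\<bar>"
  shows "\<exists>j::nat. (cosh (1 / real (Suc j)) - 1) / 2 < (1 - cos (1 / real (Suc j) * x)) / 2"
proof -
  have "((\<lambda>t. (1 - cos (t * x) - (cosh t - 1)) / t\<^sup>2) \<longlongrightarrow> x * x / 2 - 1 / 2) (at_right 0)"
    unfolding cosh_field_def by real_asymp
  moreover have "0 < x * x / 2 - 1 / 2"
    using assms mult_strict_mono[of 1 "\<bar>x\<bar>" 1 "\<bar>x\<bar>"] by (simp add: abs_mult_self_eq)
  ultimately have "\<forall>\<^sub>F t in at_right 0. 0 < (1 - cos (t * x) - (cosh t - 1)) / t\<^sup>2"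
    by (rule order_tendstoD)
  moreover have "filterlim (\<lambda>j. 1 / real (Suc j)) (at_right 0) sequentially"
    by real_asymp
  ultimately have "\<forall>\<^sub>F j in sequentially. 0 < (1 - cos (1 / real (Suc j) * x) - (cosh (1 / real (Suc j)) - 1)) / (1 / real (Suc j))\<^sup>2"
    by (rule eventually_compose_filterlim)
  then obtain j where "0 < (1 - cos (1 / real (Suc j) * x) - (cosh (1 / real (Suc j)) - 1)) / (1 / real (Suc j))\<^sup>2"
    by (auto simp: eventually_sequentially)
  then have "0 < 1 - cos (1 / real (Suc j) * x) - (cosh (1 / real (Suc j)) - 1)"
    by (simp only: zero_less_divide_iff) (auto simp: not_less)
  then show ?thesis
    by (intro exI[of _ j]) simp
qed

lemma closable_AE_abs_le_1:
  fixes M :: "real measure"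
  assumes M: "finite_measure M" "exp_integrable M" and sets: "sets M = sets borel"
    and closable: "closable_on fin_seqs M power_series_op"
  shows "AE x in M. \<bar>x\<bar> \<le> 1"
proof -
  have cos_le: "AE x in M. (1 - cos (a * x)) / 2 \<le> (cosh a - 1) / 2" if "0 \<le> a" for a
  proof -
    let ?w = "\<lambda>x. (1 - cos (a * x)) / 2" and ?r = "(cosh a - 1) / 2"
    have w: "0 \<le> ?w x" "?w x \<le> 1" for x
      by auto
    \<comment> \<open>\<open>closable_majorized_less\<close> needs a level strictly above
      \<open>?r\<close> and at most \<open>1\<close>; a level above \<open>1\<close> is never
      reached by \<open>?w\<close>.\<close>
    have "AE x in M. ?w x < ?r + 1 / real (Suc n)" for n
    proof (cases "?r + 1 / real (Suc n) \<le> 1")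
      case True
      then show ?thesis
        using w cosh_real_ge_1[of a] that
        by (intro closable_majorized_less[OF M sets closable majorized_one_minus_cos]) auto
    next
      case False
      then show ?thesis
        using w(2) by (intro AE_I2) (metis not_le order_le_less_trans)
    qed
    then have "AE x in M. \<forall>n. ?w x < ?r + 1 / real (Suc n)"
      by (simp add: AE_all_countable)
    then show ?thesis
    proof eventually_elim
      case (elim x)
      have "(\<lambda>n. ?r + 1 / real (Suc n)) \<longlonglongrightarrow> ?r + 0"
        by (intro tendsto_intros LIMSEQ_inverse_real_of_nat[unfolded inverse_eq_divide])
      then have "(\<lambda>n. ?r + 1 / real (Suc n)) \<longlonglongrightarrow> ?r"
        by (simp only: add_0_right)
      then show ?case
        by (rule LIMSEQ_le_const) (use elim in \<open>blast intro: less_imp_le\<close>)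
    qed
  qed
  \<comment> \<open>The exceptional null set depends on \<open>a\<close>, so \<open>a\<close> runs
    through a countable family tending to zero.\<close>
  have "AE x in M. \<forall>j. (1 - cos (1 / real (Suc j) * x)) / 2 \<le> (cosh (1 / real (Suc j)) - 1) / 2"
    unfolding AE_all_countable by (intro allI cos_le) simp
  then show ?thesis
  proof eventually_elim
    case (elim x)
    show ?case
    proof (rule ccontr)
      assume "\<not> \<bar>x\<bar> \<le> 1"
      then obtain j :: nat where "(cosh (1 / real (Suc j)) - 1) / 2 < (1 - cos (1 / real (Suc j) * x)) / 2"
        using one_minus_cos_gt_cosh_minus_one[of x] by (auto simp only: not_le)
      with elim show False
        by (meson not_le)
    qed
  qed
qed

section \<open>Excluding atoms at the endpoints\<close>

text \<open>The coefficients of the Cesaro means have l^1 norm \<open>1\<close> but squared l^2 norm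
  1 / (m + 1), so the argument uses l^2 directly instead of \<open>majorized\<close>. On [-1, 1] the
  means are bounded by \<open>1\<close> and converge to the indicator of \<open>s\<close>.\<close>

lemma closable_no_unit_atom:
  fixes M :: "real measure"
  assumes M: "finite_measure M" and sets [measurable_cong]: "sets M = sets borel"
    and closable: "closable_on fin_seqs M power_series_op"
    and support: "AE x in M. \<bar>x\<bar> \<le> 1" and s: "\<bar>s\<bar> = 1"
  shows "AE x in M. x \<noteq> s"
proof -
  interpret finite_measure M by fact
  have ss: "s * s = 1"
    using s by (auto simp: abs_if split: if_splits)
  define h where "h x = (if x = s then 1 else 0 :: real)" for x
  have [measurable]: "h \<in> borel_measurable borel"
    unfolding h_def by measurable
  define P where "P m x = (\<Sum>n<Suc m. s ^ n / real (Suc m) * x ^ n)" for m and x :: real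
  have P_eq: "P m x = (\<Sum>n<Suc m. (s * x) ^ n) / real (Suc m)" for m x
    by (simp add: P_def power_mult_distrib sum_divide_distrib del: sum.lessThan_Suc)
  have P_le: "\<bar>P m x\<bar> \<le> 1" if "\<bar>x\<bar> \<le> 1" for m x
  proof -
    have "\<bar>\<Sum>n<Suc m. (s * x) ^ n\<bar> \<le> (\<Sum>n<Suc m. 1)"
      by (intro order_trans[OF sum_abs] sum_mono)
        (use s that in \<open>auto simp: abs_mult power_abs intro: power_le_one\<close>)
    then show ?thesis
      by (simp add: P_eq abs_divide del: sum.lessThan_Suc)
  qed
  have P_lim: "(\<lambda>m. P m x) \<longlonglongrightarrow> h x" if x: "\<bar>x\<bar> \<le> 1" for x
  proof (cases "x = s")
    case True
    then show ?thesis
      by (simp add: P_eq h_def ss del: sum.lessThan_Suc)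
  next
    case False
    then have "s * x \<noteq> 1"
      using ss by (metis mult.assoc mult.commute mult_1)
    \<comment> \<open>The closed form bounds the geometric sum independently of \<open>m\<close>,
      also at x = -s, where the powers merely oscillate.\<close>
    have "\<bar>P m x\<bar> \<le> 2 / \<bar>s * x - 1\<bar> * (1 / real (Suc m))" for m
    proof -
      have "\<bar>(s * x) ^ Suc m\<bar> \<le> 1"
        using s x by (simp add: abs_mult power_abs power_le_one del: power_Suc)
      then have "\<bar>(s * x) ^ Suc m - 1\<bar> \<le> 2"
        by linarith
      then have "\<bar>((s * x) ^ Suc m - 1) / (s * x - 1)\<bar> \<le> 2 / \<bar>s * x - 1\<bar>"
        by (simp add: abs_divide divide_right_mono del: power_Suc)
      then have "\<bar>((s * x) ^ Suc m - 1) / (s * x - 1)\<bar> * (1 / real (Suc m)) \<le> 2 / \<bar>s * x - 1\<bar> * (1 / real (Suc m))"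
        by (rule mult_right_mono) simp
      moreover have "\<bar>A / real (Suc m)\<bar> = \<bar>A\<bar> * (1 / real (Suc m))" for A :: real
        by simp
      ultimately show ?thesis
        unfolding P_eq geometric_sum[OF \<open>s * x \<noteq> 1\<close>] by (simp only:)
    qed
    moreover have "(\<lambda>m. 2 / \<bar>s * x - 1\<bar> * (1 / real (Suc m))) \<longlonglongrightarrow> 0"
      by real_asymp
    ultimately have "(\<lambda>m. P m x) \<longlonglongrightarrow> 0"
      by (intro Lim_null_comparison[of "\<lambda>m. P m x"] always_eventually allI) auto
    then show ?thesis
      using False by (simp add: h_def)
  qed
  have "AE x in M. h x = 0"
  proof (rule closable_polynomial_limit[OF M sets closable])
    show "\<bar>h x\<bar> \<le> 1" for x
      by (simp add: h_def)
    have "(\<Sum>n<Suc m. (s ^ n / real (Suc m))\<^sup>2) = 1 / real (Suc m)" for m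
    proof -
      have "(s ^ n / real (Suc m))\<^sup>2 = 1 / real (Suc m) ^ 2" for n
        by (simp add: power_divide ss power2_eq_square flip: power_mult_distrib)
      then show ?thesis
        by (simp add: power2_eq_square del: sum.lessThan_Suc)
    qed
    then show "(\<lambda>m. \<Sum>n<Suc m. (s ^ n / real (Suc m))\<^sup>2) \<longlonglongrightarrow> 0"
      using LIMSEQ_inverse_real_of_nat by (simp only: inverse_eq_divide)
    have "(\<lambda>m. \<integral>x. (P m x - h x)\<^sup>2 \<partial>M) \<longlonglongrightarrow> (\<integral>x. 0 \<partial>M)"
    proof (rule integral_dominated_convergence[where w = "\<lambda>_. 4"])
      show "AE x in M. (\<lambda>m. (P m x - h x)\<^sup>2) \<longlonglongrightarrow> 0"
        using support
      proof eventually_elim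
        case (elim x)
        show ?case
          using tendsto_power[OF tendsto_diff[OF P_lim[OF elim] tendsto_const[of "h x"]], of 2] by simp
      qed
      show "AE x in M. norm ((P m x - h x)\<^sup>2) \<le> 4" for m
        using support
      proof eventually_elim
        case (elim x)
        have "\<bar>P m x - h x\<bar>\<^sup>2 \<le> 2\<^sup>2"
          using P_le[OF elim, of m] by (intro power_mono) (auto simp: h_def)
        then show ?case by simp
      qed
    qed (auto simp: P_def)
    then show "(\<lambda>m. \<integral>x. ((\<Sum>n<Suc m. s ^ n / real (Suc m) * x ^ n) - h x)\<^sup>2 \<partial>M) \<longlonglongrightarrow> 0"
      by (simp add: P_def del: sum.lessThan_Suc)
  qed measurable
  then show ?thesis
    by eventually_elim (auto simp: h_def)
qed

theorem theorem1p5: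
  fixes M :: "real measure"
  assumes "sets M = sets borel"
    and "has_moments M"
    and "(\<lambda>n. root (2 * n) (moment M (2 * n))) \<in> o(\<lambda>n. real n)"
  shows "determinate M \<and>
    (closable_on fin_seqs M power_series_op \<longrightarrow> emeasure M (UNIV - {-1<..<1}) = 0)"
proof (intro conjI impI)
  show "determinate M"
    using assms by (rule determinate_if_moment_growth)
next
  assume closable: "closable_on fin_seqs M power_series_op"
  have M: "finite_measure M" "exp_integrable M"
    using assms by (auto intro: has_moments_finite_measure exp_integrable_if_moment_growth)
  have le: "AE x in M. \<bar>x\<bar> \<le> 1"
    by (rule closable_AE_abs_le_1[OF M assms(1) closable])
  have "AE x in M. x \<noteq> 1" "AE x in M. x \<noteq> -1"
    by (rule closable_no_unit_atom[OF M(1) assms(1) closable le]; simp)+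
  with le have "AE x in M. x \<notin> UNIV - {-1<..<1}"
    by eventually_elim auto
  moreover have "UNIV - {-1<..<1 :: real} \<in> sets M"
    using assms(1) by simp
  ultimately show "emeasure M (UNIV - {-1<..<1}) = 0"
    using AE_iff_null_sets[of "UNIV - {-1<..<1}" M] by (simp add: null_sets_def)
qed

end
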